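(* Let $R$ be a commutative ring and let $A$ be a free $R$-algebra of rank $n$ with basis $\beta=(e_1,\dots,e_n)$. Let $A'=R\times A$ and $\beta'=((1,1),(0,e_1),\dots,(0,e_n))$. Then $$\operatorname{disc}(A,\beta)\equiv \operatorname{dpf}(A',\beta')^2 \pmod{4R}.$$
   Context: Rings have $1$. An $R$-algebra is a (not necessarily commutative) ring $A$ with a ring homomorphism $R\to A$ with image in the center of $A$; here it is assumed injective, and $R$ is identified with $R1$. $A$ is free of rank $n$ if $A\simeq R^n$ as $R$-modules; a basis is an ordered $R$-basis. For a basis $\beta=(e_1,\dots,e_n)$ and $a\in A$, $\lambda_\beta(a)=(a_{ij})\in\mathrm{M}_n(R)$ is defined by $ae_j=\sum_i a_{ij}e_i$; $t_\beta(a,b)=\operatorname{Tr}(\lambda_\beta(ab))\in R$; the Gram matrix is $B(A,\beta)=(t_\beta(e_i,e_j))_{i,j}$; and $\operatorname{disc}(A,\beta)=\det B(A,\beta)\in R$. $A'=R\times A$ is an $R$-algebra free of rank $n+1$ with basis $\beta'$, and $\operatorname{dpf}(A',\beta')=\operatorname{dpf}(B(A',\beta'))$, where for a matrix $B=(b_{ij})_{i,j=1}^m$ with entries in $R$, $$\operatorname{dpf}(B)=\sum_{\substack{J\subseteq\{2,\dots,m\}\\ \#J \text{ even}}}\ \sum_{P \text{ perfect matching on } J}\Biggl(\prod_{\{i,j\}\in P} b_{ij}\Biggr)\Biggl(\prod_{k\in\{2,\dots,m\}\setminus J} b_{1k}\Biggr)$$ (a perfect matching on $J$ is a partition of $J$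 into 2-element subsets; empty products are $1$). *)

theory Defs
  imports
    "HOL-Library.Product_Plus"
    "HOL-Library.Disjoint_Sets"
    "Jordan_Normal_Form.Determinant"
begin

section \<open>The product ring\<close>

instantiation prod :: (times, times) times
begin
definition times_prod_def: "x * y = (fst x * fst y, snd x * snd y)"
instance ..
end

instantiation prod :: (one, one) one
begin
definition one_prod_def: "1 = (1, 1)"
instance ..
end

instance prod :: (ring_1, ring_1) ring_1
  by standard
    (auto simp: times_prod_def one_prod_def plus_prod_def zero_prod_def algebra_simps)

section \<open>Algebras with a basis\<close>

text \<open>The structure map \<open>emb\<close> is an injective ring homomorphism with central image.
  The type classes exclude the zero ring, over which every congruence is trivial.\<close>

locale central_algebra = inj_ring_hom emb
  for emb :: "'r::comm_ring_1 \<Rightarrow> 'a::ring_1" +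
  assumes central: "emb r * a = a * emb r"

definition smul :: "('r::comm_ring_1 \<Rightarrow> 'a::ring_1) \<Rightarrow> 'r \<Rightarrow> 'a \<Rightarrow> 'a" where
  "smul emb r a = emb r * a"

definition is_basis :: "('r::comm_ring_1 \<Rightarrow> 'a::ring_1) \<Rightarrow> 'a list \<Rightarrow> bool" where
  "is_basis emb \<beta> \<longleftrightarrow> distinct \<beta> \<and> \<not> Modules.module.dependent (smul emb) (set \<beta>)
     \<and> Modules.module.span (smul emb) (set \<beta>) = UNIV"

text \<open>The \<open>i\<close>-th coordinate of \<open>a\<close>. Lists and matrices are indexed from 0, so
  \<open>\<beta> ! 0\<close> is the first basis element.\<close>

definition coord :: "('r::comm_ring_1 \<Rightarrow> 'a::ring_1) \<Rightarrow> 'a list \<Rightarrow> 'a \<Rightarrow> nat \<Rightarrow> 'r" where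
  "coord emb \<beta> a i = Modules.module.representation (smul emb) (set \<beta>) a (\<beta> ! i)"

definition left_mult_mat :: "('r::comm_ring_1 \<Rightarrow> 'a::ring_1) \<Rightarrow> 'a list \<Rightarrow> 'a \<Rightarrow> 'r mat" where
  "left_mult_mat emb \<beta> a =
     mat (length \<beta>) (length \<beta>) (\<lambda>(i, j). coord emb \<beta> (a * \<beta> ! j) i)"

definition mat_trace :: "'r::comm_monoid_add mat \<Rightarrow> 'r" where
  "mat_trace M = (\<Sum>i<dim_row M. M $$ (i, i))"

definition trace_form :: "('r::comm_ring_1 \<Rightarrow> 'a::ring_1) \<Rightarrow> 'a list \<Rightarrow> 'a \<Rightarrow> 'a \<Rightarrow> 'r" where
  "trace_form emb \<beta> a b = mat_trace (left_mult_mat emb \<beta> (a * b))"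

definition gram :: "('r::comm_ring_1 \<Rightarrow> 'a::ring_1) \<Rightarrow> 'a list \<Rightarrow> 'r mat" where
  "gram emb \<beta> =
     mat (length \<beta>) (length \<beta>) (\<lambda>(i, j). trace_form emb \<beta> (\<beta> ! i) (\<beta> ! j))"

definition disc :: "('r::comm_ring_1 \<Rightarrow> 'a::ring_1) \<Rightarrow> 'a list \<Rightarrow> 'r" where
  "disc emb \<beta> = det (gram emb \<beta>)"

section \<open>The invariant dpf\<close>

definition perfect_matchings :: "'v set \<Rightarrow> 'v set set set" where
  "perfect_matchings J = {P. partition_on J P \<and> (\<forall>e\<in>P. card e = 2)}"

text \<open>The distinguished first index is 0. The entry attached to an edge \<open>{i, j}\<close> is read off
  above the diagonal; for the (symmetric) Gram matrices the order of \<open>i\<close> and \<open>j\<close> is irrelevant.\<close>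

definition dpf_mat :: "'r::comm_ring_1 mat \<Rightarrow> 'r" where
  "dpf_mat B = (\<Sum>J | J \<subseteq> {1..<dim_row B} \<and> even (card J). \<Sum>P\<in>perfect_matchings J.
     (\<Prod>e\<in>P. B $$ (Min e, Max e)) * (\<Prod>k\<in>{1..<dim_row B} - J. B $$ (0, k)))"

definition dpf :: "('r::comm_ring_1 \<Rightarrow> 'a::ring_1) \<Rightarrow> 'a list \<Rightarrow> 'r" where
  "dpf emb \<beta> = dpf_mat (gram emb \<beta>)"

section \<open>The algebra \<open>R \<times> A\<close>\<close>

definition ext_emb :: "('r::comm_ring_1 \<Rightarrow> 'a::ring_1) \<Rightarrow> 'r \<Rightarrow> 'r \<times> 'a" where
  "ext_emb emb r = (r, emb r)"

definition ext_basis :: "'a::ring_1 list \<Rightarrow> ('r::comm_ring_1 \<times> 'a) list" where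
  "ext_basis \<beta> = (1, 1) # map (\<lambda>e. (0, e)) \<beta>"

lemma (in central_algebra) module_smul: "Modules.module (smul emb)"
  by standard (simp_all add: smul_def algebra_simps hom_add hom_mult)

lemma (in central_algebra) central_algebra_ext: "central_algebra (ext_emb emb)"
proof
  fix r :: 'r and a :: "'r \<times> 'a"
  show "ext_emb emb r * a = a * ext_emb emb r"
    using central[of r "snd a"] by (simp add: ext_emb_def times_prod_def mult.commute)
qed (auto simp: ext_emb_def times_prod_def one_prod_def plus_prod_def zero_prod_def
      hom_add hom_mult)

lemma (in central_algebra) is_basis_ext:
  assumes "is_basis emb \<beta>"
  shows "is_basis (ext_emb emb) (ext_basis \<beta>)"
proof -
  interpret M: Modules.module "smul emb" by (rule module_smul)
  interpret E: central_algebra "ext_emb emb" by (rule central_algebra_ext)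
  interpret N: Modules.module "smul (ext_emb emb)" by (rule E.module_smul)
  let ?f = "\<lambda>e::'a. (0::'r, e)"
  from assms have d: "distinct \<beta>" and ind: "\<not> M.dependent (set \<beta>)"
    and sp: "M.span (set \<beta>) = UNIV"
    by (auto simp: is_basis_def)
  have inj: "inj_on ?f S" for S by (auto simp: inj_on_def)
  have sc: "smul (ext_emb emb) r (x, a) = (r * x, smul emb r a)" for r x a
    by (simp add: smul_def ext_emb_def times_prod_def)
  have smul1: "smul emb r 1 = emb r" for r
    by (simp add: smul_def)
  have sum0: "(\<Sum>v\<in>?f ` S. smul (ext_emb emb) (u v) v)
      = (0, \<Sum>a\<in>S. smul emb (u (0, a)) a)" if "finite S" for u and S :: "'a set"
  proof -
    have "(\<Sum>v\<in>?f ` S. smul (ext_emb emb) (u v) v) = (\<Sum>a\<in>S. (0, smul emb (u (0, a)) a))"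
      by (simp add: sum.reindex[OF inj] sc)
    also have "\<dots> = (0, \<Sum>a\<in>S. smul emb (u (0, a)) a)"
      using that by (induction S) (auto simp: zero_prod_def)
    finally show ?thesis .
  qed
  have set': "set (ext_basis \<beta>) = insert (1, 1) (?f ` set \<beta>)"
    by (auto simp: ext_basis_def)
  have notin: "((1::'r), (1::'a)) \<notin> ?f ` S" for S by auto
  have dist: "distinct (ext_basis \<beta> :: ('r \<times> 'a) list)"
    using d inj by (auto simp: ext_basis_def distinct_map)
  have indep: "\<not> N.dependent (set (ext_basis \<beta>))"
  proof
    assume "N.dependent (set (ext_basis \<beta>))"
    then obtain u v0 where v0: "v0 \<in> set (ext_basis \<beta>)" "u v0 \<noteq> 0"
      and z: "(\<Sum>v\<in>set (ext_basis \<beta>). smul (ext_emb emb) (u v) v) = 0"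
      by (subst (asm) N.dependent_finite) auto
    have eq: "smul (ext_emb emb) (u (1, 1)) (1, 1)
        + (0, \<Sum>a\<in>set \<beta>. smul emb (u (0, a)) a) = 0"
      using z by (simp add: set' sum.insert[OF _ notin] sum0)
    then have u1: "u (1, 1) = 0"
      by (simp add: sc smul1 plus_prod_def zero_prod_def)
    with eq have "(\<Sum>a\<in>set \<beta>. smul emb (u (0, a)) a) = 0"
      by (simp add: sc smul1 plus_prod_def zero_prod_def)
    then have "\<forall>a\<in>set \<beta>. u (0, a) = 0"
      using ind by (subst (asm) M.dependent_finite) auto
    with u1 v0 show False by (auto simp: set')
  qed
  have span: "N.span (set (ext_basis \<beta>)) = UNIV"
  proof -
    have A: "(0, a) \<in> N.span (?f ` set \<beta>)" for a
    proof -
      have "a \<in> M.span (set \<beta>)" using sp by simp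
      then obtain u where "a = (\<Sum>v\<in>set \<beta>. smul emb (u v) v)"
        by (subst (asm) M.span_finite) auto
      then have "(0, a) = (\<Sum>v\<in>?f ` set \<beta>. smul (ext_emb emb) (u (snd v)) v)"
        by (simp add: sum0)
      then show ?thesis
        by (simp add: N.span_sum N.span_scale N.span_base)
    qed
    have "(x, a) \<in> N.span (set (ext_basis \<beta>))" for x a
    proof -
      have "smul (ext_emb emb) x (1, 1) + (0, a - emb x) \<in> N.span (set (ext_basis \<beta>))"
      proof (rule N.span_add)
        show "smul (ext_emb emb) x (1, 1) \<in> N.span (set (ext_basis \<beta>))"
          by (intro N.span_scale N.span_base) (simp add: set')
        show "(0, a - emb x) \<in> N.span (set (ext_basis \<beta>))"
          using A N.span_mono[of "?f ` set \<beta>" "set (ext_basis \<beta>)"] by (auto simp: set')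
      qed
      then show ?thesis by (simp add: sc smul1 plus_prod_def)
    qed
    then show ?thesis by auto
  qed
  show ?thesis using dist indep span by (simp add: is_basis_def)
qed

end

theory Submission
  imports Defs
begin

text \<open>Write \<open>T\<close> for the Gram matrix of the trace form, \<open>x\<^sub>i\<close> for the trace of \<open>e\<^sub>i\<close> and
  \<open>1 = \<Sum>\<^sub>i a\<^sub>i e\<^sub>i\<close>, so that \<open>T a = x\<close> and \<open>x \<cdot> a = n\<close>.  The symmetric matrix \<open>Q = T - x x\<^sup>T\<close> has even
  diagonal, because \<open>Tr M\<^sup>2\<close> and \<open>(Tr M)\<^sup>2\<close> agree modulo 2.  Row and column operations give
  \<open>det Q = (1 - n) disc\<close>, and \<open>det [[0, x\<^sup>T], [x, Q]] = - n disc\<close>.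

  For a symmetric matrix of even size \<open>2 m\<close> with even diagonal, the determinant is congruent modulo
  4 to \<open>(-1)\<^sup>m\<close> times the square of the sum over all perfect matchings.  Apply this to \<open>Q\<close> when \<open>n\<close> is
  even and to the bordered matrix when \<open>n\<close> is odd; the factor of disc is \<open>1 - 2 m\<close> in both cases,
  which is \<open>(-1)\<^sup>m\<close> modulo 4.  Modulo 2, expanding the products
  \<open>\<Prod>(T\<^sub>i\<^sub>j + x\<^sub>i x\<^sub>j)\<close> turns the matching sum into dpf, since a set of even size has an odd number of
  perfect matchings; squaring lifts the congruence to modulo 4.\<close>

section \<open>Determinants over index sets\<close>

text \<open>The Leibniz sum over an arbitrary finite index set: the inductions below delete indices,
  which is then set difference without renumbering.\<close>

definition det_on :: "('i \<Rightarrow> 'i \<Rightarrow> 'r::comm_ring_1) \<Rightarrow> 'i set \<Rightarrow> 'r" where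
  "det_on N A = (\<Sum>\<sigma> | \<sigma> permutes A. of_int (sign \<sigma>) * (\<Prod>i\<in>A. N i (\<sigma> i)))"

text \<open>The signs come from permutations of the whole of \<open>A\<close>, so that this is the usual
  cofactor, with no dependence on an ordering of the index set.\<close>

definition minor_on :: "('i \<Rightarrow> 'i \<Rightarrow> 'r::comm_ring_1) \<Rightarrow> 'i set \<Rightarrow> 'i \<Rightarrow> 'i \<Rightarrow> 'r" where
  "minor_on N A k l =
     (\<Sum>\<sigma> | \<sigma> permutes A \<and> \<sigma> k = l. of_int (sign \<sigma>) * (\<Prod>i\<in>A - {k}. N i (\<sigma> i)))"

lemma det_on_empty [simp]: "det_on N {} = 1"
  by (simp add: det_on_def)

lemma det_on_cong:
  assumes "\<And>i j. i \<in> A \<Longrightarrow> j \<in> A \<Longrightarrow> N i j = N' i j"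
  shows "det_on N A = det_on N' A"
  unfolding det_on_def
  by (intro sum.cong refl arg_cong2[of _ _ _ _ times] prod.cong)
    (auto intro!: assms simp: permutes_in_image)

lemma det_on_row_expand:
  assumes "finite A" "a \<in> A"
  shows "det_on N A = (\<Sum>l\<in>A. N a l * minor_on N A a l)"
proof -
  have "det_on N A = (\<Sum>l\<in>A. \<Sum>\<sigma>\<in>{\<sigma>. \<sigma> permutes A \<and> \<sigma> a = l}.
      of_int (sign \<sigma>) * (\<Prod>i\<in>A. N i (\<sigma> i)))"
    unfolding det_on_def
    using sum.group[of "{\<sigma>. \<sigma> permutes A}" A "\<lambda>\<sigma>. \<sigma> a"
        "\<lambda>\<sigma>. of_int (sign \<sigma>) * (\<Prod>i\<in>A. N i (\<sigma> i))"] assms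
    by (simp add: finite_permutations image_subset_iff permutes_in_image)
  also have "\<dots> = (\<Sum>l\<in>A. N a l * minor_on N A a l)"
    unfolding minor_on_def sum_distrib_left
    by (intro sum.cong refl) (auto simp: prod.remove[OF assms] mult_ac)
  finally show ?thesis .
qed

text \<open>Composition with the transposition of \<open>k\<close> and \<open>l\<close> turns
  permutations taking \<open>k\<close> to \<open>l\<close> into permutations fixing
  \<open>k\<close>. Where the new permutation has the value \<open>l\<close>, the entry comes from
  column \<open>k\<close>; for \<open>k \<noteq> l\<close> the sign flips.\<close>

lemma minor_on_alt:
  assumes "finite A" "k \<in> A" "l \<in> A"
  shows "minor_on N A k l = (if k = l then 1 else -1) *
    det_on (\<lambda>i j. if j = l then N i k else N i j) (A - {k})"
proof -
  let ?t = "transpose k l"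
  let ?N = "\<lambda>i j. if j = l then N i k else N i j"
  have inv: "?t \<circ> (?t \<circ> \<tau>) = \<tau>" for \<tau> :: "'a \<Rightarrow> 'a"
    by (simp add: comp_assoc[symmetric])
  have tA: "?t permutes A" using assms by (simp add: permutes_swap_id)
  have "minor_on N A k l = (\<Sum>\<tau> | \<tau> permutes A - {k}.
      of_int (sign (?t \<circ> \<tau>)) * (\<Prod>i\<in>A - {k}. N i ((?t \<circ> \<tau>) i)))"
    unfolding minor_on_def
  proof (rule sum.reindex_bij_witness[where i = "\<lambda>\<tau>. ?t \<circ> \<tau>" and j = "\<lambda>\<sigma>. ?t \<circ> \<sigma>"])
    fix \<sigma> assume s: "\<sigma> \<in> {\<sigma>. \<sigma> permutes A \<and> \<sigma> k = l}"
    then have "?t \<circ> \<sigma> permutes A" using tA by (simp add: permutes_compose)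
    then show "?t \<circ> \<sigma> \<in> {\<tau>. \<tau> permutes A - {k}}"
      using s by (simp, elim permutes_superset) auto
  next
    fix \<tau> assume t: "\<tau> \<in> {\<tau>. \<tau> permutes A - {k}}"
    then have "\<tau> permutes A" by (simp, elim permutes_subset) auto
    moreover have "\<tau> k = k" using t by (simp add: permutes_not_in)
    ultimately show "?t \<circ> \<tau> \<in> {\<sigma>. \<sigma> permutes A \<and> \<sigma> k = l}"
      using tA by (simp add: permutes_compose)
  qed (auto simp: inv)
  also have "\<dots> = (\<Sum>\<tau> | \<tau> permutes A - {k}. (if k = l then 1 else -1) *
      (of_int (sign \<tau>) * (\<Prod>i\<in>A - {k}. ?N i (\<tau> i))))"
  proof (intro sum.cong refl)
    fix \<tau> assume "\<tau> \<in> {\<tau>. \<tau> permutes A - {k}}"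
    then have t: "\<tau> permutes A - {k}" by simp
    have "permutation \<tau>" "permutation ?t"
      using t assms(1) permutation_permutes by (auto simp: permutation_swap_id)
    then have sg: "sign (?t \<circ> \<tau>) = (if k = l then 1 else -1) * sign \<tau>"
      by (simp add: sign_compose sign_swap_id)
    have "(\<Prod>i\<in>A - {k}. N i ((?t \<circ> \<tau>) i)) = (\<Prod>i\<in>A - {k}. ?N i (\<tau> i))"
    proof (intro prod.cong refl)
      fix i assume "i \<in> A - {k}"
      then have "\<tau> i \<in> A - {k}" using t by (simp add: permutes_in_image del: Diff_iff)
      then show "N i ((?t \<circ> \<tau>) i) = ?N i (\<tau> i)" by (auto simp: transpose_def)
    qed
    then show "of_int (sign (?t \<circ> \<tau>)) * (\<Prod>i\<in>A - {k}. N i ((?t \<circ> \<tau>) i)) =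
        (if k = l then 1 else -1) * (of_int (sign \<tau>) * (\<Prod>i\<in>A - {k}. ?N i (\<tau> i)))"
      by (simp add: sg)
  qed
  finally show ?thesis by (simp add: det_on_def sum_distrib_left)
qed

text \<open>Inverting the permutations exchanges \<open>k\<close> and \<open>l\<close> and keeps the
  signs.\<close>

lemma minor_on_transpose:
  assumes "finite A" "k \<in> A" "l \<in> A"
  shows "minor_on (\<lambda>i j. N j i) A k l = minor_on N A l k"
  unfolding minor_on_def
proof (rule sum.reindex_bij_witness[where i = "inv_into UNIV" and j = "inv_into UNIV"])
  fix \<sigma> assume s: "\<sigma> \<in> {\<sigma>. \<sigma> permutes A \<and> \<sigma> k = l}"
  then show "inv_into UNIV (inv_into UNIV \<sigma>) = \<sigma>" "inv_into UNIV \<sigma> \<in> {\<sigma>. \<sigma> permutes A \<and> \<sigma> l = k}"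
    by (auto simp: permutes_inv permutes_inv_inv permutes_inv_eq)
  have "permutation \<sigma>" using s assms(1) permutation_permutes by auto
  moreover have "(\<Prod>i\<in>A - {l}. N i (inv_into UNIV \<sigma> i)) = (\<Prod>i\<in>A - {k}. N (\<sigma> i) i)"
  proof (rule prod.reindex_bij_witness[where i = \<sigma> and j = "inv_into UNIV \<sigma>"])
    fix i assume i: "i \<in> A - {k}"
    then show "\<sigma> i \<in> A - {l}" using s
      by (auto simp: permutes_in_image dest: permutes_inj injD)
  next
    fix i assume i: "i \<in> A - {l}"
    then show "inv_into UNIV \<sigma> i \<in> A - {k}" using s permutes_inv[of \<sigma> A]
      by (auto simp: permutes_in_image permutes_inv_eq)
  qed (use s in \<open>auto simp: permutes_inverses\<close>)
  ultimately show "of_int (sign (inv_into UNIV \<sigma>)) * (\<Prod>i\<in>A - {l}. N i (inv_into UNIV \<sigma> i)) =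
      of_int (sign \<sigma>) * (\<Prod>i\<in>A - {k}. N (\<sigma> i) i)"
    by (simp add: sign_inverse)
next
  fix \<sigma> assume s: "\<sigma> \<in> {\<sigma>. \<sigma> permutes A \<and> \<sigma> l = k}"
  then show "inv_into UNIV (inv_into UNIV \<sigma>) = \<sigma>" "inv_into UNIV \<sigma> \<in> {\<sigma>. \<sigma> permutes A \<and> \<sigma> k = l}"
    by (auto simp: permutes_inv permutes_inv_inv permutes_inv_eq)
qed

lemma det_on_transpose:
  assumes "finite A"
  shows "det_on (\<lambda>i j. N j i) A = det_on N A"
  unfolding det_on_def
proof (rule sum.reindex_bij_witness[where i = "inv_into UNIV" and j = "inv_into UNIV"])
  fix \<sigma> assume s: "\<sigma> \<in> {\<sigma>. \<sigma> permutes A}"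
  then show "inv_into UNIV (inv_into UNIV \<sigma>) = \<sigma>" "inv_into UNIV \<sigma> \<in> {\<sigma>. \<sigma> permutes A}"
    "inv_into UNIV (inv_into UNIV \<sigma>) = \<sigma>" "inv_into UNIV \<sigma> \<in> {\<sigma>. \<sigma> permutes A}"
    by (auto simp: permutes_inv permutes_inv_inv)
  have "permutation \<sigma>" using s assms(1) permutation_permutes by auto
  moreover have "(\<Prod>i\<in>A. N i (inv_into UNIV \<sigma> i)) = (\<Prod>i\<in>A. N (\<sigma> i) i)"
    using s permutes_inv[of \<sigma> A]
    by (intro prod.reindex_bij_witness[where i = \<sigma> and j = "inv_into UNIV \<sigma>"])
      (auto simp: permutes_inverses permutes_in_image)
  ultimately show "of_int (sign (inv_into UNIV \<sigma>)) * (\<Prod>i\<in>A. N i (inv_into UNIV \<sigma> i)) =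
      of_int (sign \<sigma>) * (\<Prod>i\<in>A. N (\<sigma> i) i)"
    by (simp add: sign_inverse)
qed

lemma det_on_col_expand:
  assumes "finite A" "a \<in> A"
  shows "det_on N A = (\<Sum>k\<in>A. N k a * minor_on N A k a)"
proof -
  have "det_on N A = (\<Sum>k\<in>A. N k a * minor_on (\<lambda>i j. N j i) A a k)"
    using det_on_row_expand[OF assms, of "\<lambda>i j. N j i"] det_on_transpose[OF assms(1), of N]
    by simp
  also have "\<dots> = (\<Sum>k\<in>A. N k a * minor_on N A k a)"
    using assms by (intro sum.cong refl arg_cong2[of _ _ _ _ times] minor_on_transpose)
  finally show ?thesis .
qed

lemma minor_on_cong:
  assumes "finite A" "k \<in> A" "l \<in> A"
    and "\<And>i j. i \<in> A \<Longrightarrow> j \<in> A \<Longrightarrow> i \<noteq> k \<Longrightarrow> j \<noteq> l \<Longrightarrow> N i j = N' i j"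
  shows "minor_on N A k l = minor_on N' A k l"
  unfolding minor_on_alt[OF assms(1-3)]
  by (intro arg_cong2[of _ _ _ _ times] det_on_cong refl) (use assms(2-4) in auto)

lemma minor_on_same: "finite A \<Longrightarrow> k \<in> A \<Longrightarrow> minor_on N A k k = det_on N (A - {k})"
  by (simp add: minor_on_alt cong: if_cong) (rule det_on_cong, auto)

text \<open>Expansion along row and column \<open>a\<close> at once. After the row expansion, the
  minor at \<open>(a, l)\<close> with \<open>l \<noteq> a\<close> is minus a determinant on
  \<open>A - {a}\<close> whose column \<open>l\<close> holds column \<open>a\<close>. Expanding
  along that column deletes it, so the remaining minors are those of \<open>N\<close>.\<close>

lemma det_on_expand:
  assumes "finite A" "a \<in> A"
  shows "det_on N A = N a a * det_on N (A - {a}) -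
    (\<Sum>k\<in>A - {a}. \<Sum>l\<in>A - {a}. N k a * N a l * minor_on N (A - {a}) k l)"
proof -
  have "minor_on N A a l = - (\<Sum>k\<in>A - {a}. N k a * minor_on N (A - {a}) k l)"
    if l: "l \<in> A - {a}" for l
  proof -
    let ?N = "\<lambda>i j. if j = l then N i a else N i j"
    have "minor_on N A a l = - det_on ?N (A - {a})"
      using assms l by (auto simp: minor_on_alt)
    also have "\<dots> = - (\<Sum>k\<in>A - {a}. N k a * minor_on ?N (A - {a}) k l)"
      using assms l by (subst det_on_col_expand[of _ l]) auto
    also have "\<dots> = - (\<Sum>k\<in>A - {a}. N k a * minor_on N (A - {a}) k l)"
      using assms l
      by (intro arg_cong[of _ _ uminus] sum.cong refl arg_cong2[of _ _ _ _ times] minor_on_cong)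
        auto
    finally show ?thesis .
  qed
  then have "(\<Sum>l\<in>A - {a}. N a l * minor_on N A a l) =
      - (\<Sum>l\<in>A - {a}. \<Sum>k\<in>A - {a}. N k a * N a l * minor_on N (A - {a}) k l)"
    by (simp add: sum_negf[symmetric] sum_distrib_left mult_ac)
  also have "\<dots> = - (\<Sum>k\<in>A - {a}. \<Sum>l\<in>A - {a}. N k a * N a l * minor_on N (A - {a}) k l)"
    by (subst sum.swap) simp
  finally show ?thesis
    using assms by (simp add: det_on_row_expand[of A a] sum.remove[of A a] minor_on_same)
qed

text \<open>The minor is minus a determinant on \<open>A - {k}\<close>, to which
  \<open>det_on_expand\<close> applies at \<open>l\<close>. There column \<open>l\<close> holds
  column \<open>k\<close> of \<open>N\<close>, hence the entries \<open>N i k\<close> and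
  \<open>N l k\<close>.\<close>

lemma minor_on_expand:
  assumes "finite A" "k \<in> A" "l \<in> A" "k \<noteq> l"
  shows "minor_on N A k l = (\<Sum>i\<in>A - {k, l}. \<Sum>j\<in>A - {k, l}.
      N i k * N l j * minor_on N (A - {k, l}) i j) - N l k * det_on N (A - {k, l})"
proof -
  let ?N = "\<lambda>i j. if j = l then N i k else N i j"
  have e: "A - {k} - {l} = A - {k, l}" by auto
  have "minor_on N A k l = - det_on ?N (A - {k})"
    using assms by (simp add: minor_on_alt)
  also have "\<dots> = (\<Sum>i\<in>A - {k, l}. \<Sum>j\<in>A - {k, l}.
      ?N i l * ?N l j * minor_on ?N (A - {k, l}) i j) - ?N l l * det_on ?N (A - {k, l})"
    using assms by (subst det_on_expand[of _ l]) (auto simp: e)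
  also have "\<dots> = (\<Sum>i\<in>A - {k, l}. \<Sum>j\<in>A - {k, l}.
      N i k * N l j * minor_on N (A - {k, l}) i j) - N l k * det_on N (A - {k, l})"
    using assms
    by (intro arg_cong2[of _ _ _ _ minus] sum.cong arg_cong2[of _ _ _ _ times] refl
        minor_on_cong det_on_cong) auto
  finally show ?thesis .
qed

section \<open>Matching sums and determinants modulo 4\<close>

lemma dvd_diff_mult:
  fixes m :: "'r::comm_ring_1"
  assumes "m dvd a - b" "m dvd c - d"
  shows "m dvd a * c - b * d"
proof -
  have "a * c - b * d = (a - b) * c + b * (c - d)" by (simp add: algebra_simps)
  then show ?thesis using assms by simp
qed

lemma dvd_diff_sum:
  fixes m :: "'r::comm_ring_1"
  assumes "\<And>i. i \<in> S \<Longrightarrow> m dvd f i - g i"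
  shows "m dvd sum f S - sum g S"
  unfolding sum_subtractf[symmetric] using assms by (rule dvd_sum)

lemma dvd_diff_trans:
  fixes m :: "'r::comm_ring_1"
  assumes "m dvd a - b" "m dvd b - c"
  shows "m dvd a - c"
  using dvd_add[OF assms] by simp

lemma dvd_if_dvd_diff:
  fixes m :: "'r::comm_ring_1"
  assumes "m dvd a - b" "m dvd b"
  shows "m dvd a"
  using dvd_diff_trans[of m a b 0] assms by simp

lemma dvd_square_diff:
  fixes a b :: "'r::comm_ring_1"
  assumes "2 dvd a - b"
  shows "4 dvd a\<^sup>2 - b\<^sup>2"
proof -
  from assms obtain k where "a - b = 2 * k" by (auto simp: dvd_def)
  then have "a = b + 2 * k" by (simp add: algebra_simps)
  then have "a\<^sup>2 - b\<^sup>2 = 4 * (b * k + k\<^sup>2)"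
    by (simp add: power2_eq_square algebra_simps)
  then show ?thesis by simp
qed

text \<open>The equal terms at \<open>(k, l)\<close> and \<open>(l, k)\<close> add up to twice one
  of them. With \<open>d = 1\<close> this removes the off-diagonal terms modulo 2; with
  \<open>d = 2\<close> it raises their evenness to divisibility by 4.\<close>

lemma dvd_symmetric_sum:
  fixes h :: "'i \<Rightarrow> 'i \<Rightarrow> 'r::comm_ring_1"
  assumes "finite S"
    and "\<And>k l. k \<in> S \<Longrightarrow> l \<in> S \<Longrightarrow> h k l = h l k"
    and "\<And>k l. k \<in> S \<Longrightarrow> l \<in> S \<Longrightarrow> k \<noteq> l \<Longrightarrow> d dvd h k l"
  shows "2 * d dvd (\<Sum>k\<in>S. \<Sum>l\<in>S. h k l) - (\<Sum>k\<in>S. h k k)"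
  using assms
proof (induction S)
  case (insert a S)
  have "(\<Sum>k\<in>S. h k a) = (\<Sum>k\<in>S. h a k)"
    using insert.prems by (intro sum.cong) auto
  then have "(\<Sum>k\<in>insert a S. \<Sum>l\<in>insert a S. h k l) - (\<Sum>k\<in>insert a S. h k k) =
      2 * (\<Sum>k\<in>S. h a k) + ((\<Sum>k\<in>S. \<Sum>l\<in>S. h k l) - (\<Sum>k\<in>S. h k k))"
    using insert.hyps by (simp add: sum.distrib algebra_simps)
  moreover have "d dvd (\<Sum>k\<in>S. h a k)"
    using insert.hyps insert.prems by (intro dvd_sum) auto
  moreover have "2 * d dvd (\<Sum>k\<in>S. \<Sum>l\<in>S. h k l) - (\<Sum>k\<in>S. h k k)"
    using insert.prems by (intro insert.IH) auto
  ultimately show ?case by (simp add: mult_dvd_mono)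
qed simp

text \<open>For symmetric \<open>N\<close> this is the hafnian, the Pfaffian with all signs dropped.
  Edges are read off as in \<open>dpf_mat\<close>.\<close>

definition matching_sum :: "('i::linorder \<Rightarrow> 'i \<Rightarrow> 'r::comm_ring_1) \<Rightarrow> 'i set \<Rightarrow> 'r" where
  "matching_sum N A = (\<Sum>P\<in>perfect_matchings A. \<Prod>e\<in>P. N (Min e) (Max e))"

section \<open>Perfect matchings and expansion along a vertex\<close>

lemma perfect_matchings_empty [simp]: "perfect_matchings {} = {{}}"
  by (auto simp: perfect_matchings_def partition_on_empty)

lemma finite_perfect_matchings: "finite A \<Longrightarrow> finite (perfect_matchings A)"
  unfolding perfect_matchings_def
  by (rule finite_subset[OF _ finitely_many_partition_on]) auto

lemma matching_sum_empty [simp]: "matching_sum N {} = 1"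
  by (simp add: matching_sum_def)

lemma perfect_matchings_insert_iff:
  assumes "a \<noteq> k" and "disjnt {a, k} (\<Union>P)"
  shows "insert {a, k} P \<in> perfect_matchings A \<longleftrightarrow>
    a \<in> A \<and> k \<in> A \<and> P \<in> perfect_matchings (A - {a, k})"
  using assms by (auto simp: perfect_matchings_def partition_on_insert)

lemma perfect_matchings_not_mem:
  "P \<in> perfect_matchings A \<Longrightarrow> a \<notin> A \<Longrightarrow> e \<in> P \<Longrightarrow> a \<notin> e"
  by (auto simp: perfect_matchings_def partition_on_def)

text \<open>A perfect matching amounts to the partner \<open>k\<close> of \<open>a\<close> and a
  perfect matching of what is left without the two.\<close>

lemma perfect_matchings_bij:
  assumes "a \<in> A"
  shows "bij_betw (\<lambda>(k, P). insert {a, k} P)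
    (SIGMA k:A - {a}. perfect_matchings (A - {a, k})) (perfect_matchings A)"
  unfolding bij_betw_def
proof (intro conjI)
  let ?D = "SIGMA k:A - {a}. perfect_matchings (A - {a, k})"
  have disj: "disjnt {a, k} (\<Union>P)" if "P \<in> perfect_matchings (A - {a, k})" for k P
    using perfect_matchings_not_mem[OF that, of a] perfect_matchings_not_mem[OF that, of k]
    by (simp add: disjnt_def)
  show "inj_on (\<lambda>(k, P). insert {a, k} P) ?D"
  proof (rule inj_onI)
    fix x y assume "x \<in> ?D" "y \<in> ?D"
      and "(case x of (k, P) \<Rightarrow> insert {a, k} P) = (case y of (k, P) \<Rightarrow> insert {a, k} P)"
    then obtain k k' P P' where xy: "x = (k, P)" "y = (k', P')"
      and P: "P \<in> perfect_matchings (A - {a, k})" "P' \<in> perfect_matchings (A - {a, k'})"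
      and eq: "insert {a, k} P = insert {a, k'} P'"
      by (cases x; cases y) simp
    have n: "{a, z} \<notin> P" "{a, z} \<notin> P'" for z
      using perfect_matchings_not_mem[OF P(1), of a "{a, z}"]
        perfect_matchings_not_mem[OF P(2), of a "{a, z}"] by auto
    then have "k = k'" using eq by (metis doubleton_eq_iff insertCI insertE)
    with n eq show "x = y" using xy by (metis insert_ident)
  qed
  show "(\<lambda>(k, P). insert {a, k} P) ` ?D = perfect_matchings A"
  proof (intro equalityI subsetI)
    fix Q assume "Q \<in> (\<lambda>(k, P). insert {a, k} P) ` ?D"
    then obtain k P where kP: "k \<in> A - {a}" "P \<in> perfect_matchings (A - {a, k})"
        "Q = insert {a, k} P"
      by auto
    then show "Q \<in> perfect_matchings A"
      using disj[OF kP(2)] assms unfolding kP(3) by (subst perfect_matchings_insert_iff) auto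
  next
    fix Q assume Q: "Q \<in> perfect_matchings A"
    then obtain e where e: "e \<in> Q" "a \<in> e" "card e = 2"
      using assms unfolding perfect_matchings_def partition_on_def by blast
    then obtain k where k: "e = {a, k}" "a \<noteq> k" unfolding card_2_iff by blast
    obtain P where P: "Q = insert {a, k} P" "{a, k} \<notin> P"
      using e(1) k(1) by (metis mk_disjoint_insert)
    have "disjnt {a, k} p" if "p \<in> P" for p
      using Q that P(2) unfolding perfect_matchings_def partition_on_def P(1)
      by (auto simp: pairwise_insert)
    then have "disjnt {a, k} (\<Union>P)" unfolding disjnt_def by blast
    then have "k \<in> A" "P \<in> perfect_matchings (A - {a, k})"
      using Q perfect_matchings_insert_iff[of a k P A, OF k(2)] unfolding P(1) by simp_all
    then have "(k, P) \<in> ?D" using k by simp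
    then show "Q \<in> (\<lambda>(k, P). insert {a, k} P) ` ?D"
      using P(1) by (intro image_eqI[of _ _ "(k, P)"]) simp_all
  qed
qed

text \<open>The edge at \<open>a\<close> is split off; by symmetry its weight is
  \<open>N a k\<close> whichever of \<open>a\<close> and \<open>k\<close> is smaller.\<close>

lemma matching_sum_expand:
  assumes "finite A" "a \<in> A" and sym: "\<And>i j. N i j = N j i"
  shows "matching_sum N A = (\<Sum>k\<in>A - {a}. N a k * matching_sum N (A - {a, k}))"
proof -
  let ?w = "\<lambda>e. N (Min e) (Max e)"
  have w: "?w {a, k} = N a k" for k
    by (cases a k rule: linorder_cases) (auto simp: sym max_def min_def)
  have "matching_sum N A = (\<Sum>(k, P)\<in>(SIGMA k:A - {a}. perfect_matchings (A - {a, k})).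
      \<Prod>e\<in>insert {a, k} P. ?w e)"
    unfolding matching_sum_def
    by (subst sum.reindex_bij_betw[OF perfect_matchings_bij[OF assms(2)], symmetric])
      (simp add: case_prod_unfold)
  also have "\<dots> = (\<Sum>k\<in>A - {a}. \<Sum>P\<in>perfect_matchings (A - {a, k}). \<Prod>e\<in>insert {a, k} P. ?w e)"
    using assms(1) by (simp add: sum.Sigma finite_perfect_matchings)
  also have "\<dots> = (\<Sum>k\<in>A - {a}. \<Sum>P\<in>perfect_matchings (A - {a, k}). N a k * (\<Prod>e\<in>P. ?w e))"
  proof (intro sum.cong refl)
    fix k P assume "k \<in> A - {a}" and P: "P \<in> perfect_matchings (A - {a, k})"
    then have "finite P"
      using assms(1) by (auto simp: perfect_matchings_def intro: finite_elements[rotated])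
    moreover have "{a, k} \<notin> P" using perfect_matchings_not_mem[OF P, of a] by auto
    ultimately show "(\<Prod>e\<in>insert {a, k} P. ?w e) = N a k * (\<Prod>e\<in>P. ?w e)"
      by (simp only: prod.insert w not_False_eq_True)
  qed
  finally show ?thesis by (simp add: matching_sum_def sum_distrib_left)
qed

section \<open>Symmetric matrices with even diagonal\<close>

context
  fixes N :: "'i::linorder \<Rightarrow> 'i \<Rightarrow> 'r::comm_ring_1"
  assumes sym: "\<And>i j. N i j = N j i"
    and diag: "\<And>i. 2 dvd N i i"
begin

lemma minor_on_sym: "finite A \<Longrightarrow> k \<in> A \<Longrightarrow> l \<in> A \<Longrightarrow> minor_on N A k l = minor_on N A l k"
proof -
  have "(\<lambda>i j. N j i) = N" by (intro ext) (rule sym)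
  then show "finite A \<Longrightarrow> k \<in> A \<Longrightarrow> l \<in> A \<Longrightarrow> minor_on N A k l = minor_on N A l k"
    using minor_on_transpose[of A k l N] by simp
qed

text \<open>The square of the expansion along \<open>a\<close>, in the shape of the double sum of
  \<open>det_on_expand\<close>, for comparison term by term.\<close>

lemma matching_sum_square:
  assumes "finite A" "a \<in> A"
  shows "(\<Sum>k\<in>A - {a}. \<Sum>l\<in>A - {a}. N k a * N a l *
    (matching_sum N (A - {a} - {k}) * matching_sum N (A - {a} - {l}))) = (matching_sum N A)\<^sup>2"
proof -
  have "A - {a, k} = A - {a} - {k}" for k by auto
  then show ?thesis
    unfolding matching_sum_expand[of A a N, OF assms sym] power2_eq_square sum_product
    by (intro sum.cong refl) (simp add: sym[of a] mult_ac)
qed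

text \<open>A division-free substitute for the identity between minors and Pfaffians: expanding the minor
  along row \<open>l\<close> and column \<open>k\<close> gives a double sum which, by the induction hypothesis, factors as
  the product of the expansions of the two matching sums along \<open>l\<close> and \<open>k\<close>.\<close>

lemma odd_minors_mod_2:
  assumes "finite A" "odd (card A)"
  shows "2 dvd det_on N A \<and> (\<forall>k\<in>A. \<forall>l\<in>A.
    2 dvd minor_on N A k l - matching_sum N (A - {k}) * matching_sum N (A - {l}))"
  using assms
proof (induction A rule: finite_psubset_induct)
  case (psubset A)
  note fin = psubset.hyps
  have odd2: "odd (card (A - {a} - {k}))" if "a \<in> A" "k \<in> A - {a}" for a k
  proof -
    have "card A = Suc (card (A - {a}))" "card (A - {a}) = Suc (card (A - {a} - {k}))"
      using fin that by (simp_all only: card.remove finite_Diff)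
    then show ?thesis using psubset.prems by presburger
  qed
  have IH: "2 dvd det_on N (A - {a} - {k})"
    "\<And>i j. i \<in> A - {a} - {k} \<Longrightarrow> j \<in> A - {a} - {k} \<Longrightarrow>
      2 dvd minor_on N (A - {a} - {k}) i j -
        matching_sum N (A - {a} - {k} - {i}) * matching_sum N (A - {a} - {k} - {j})"
    if "a \<in> A" "k \<in> A - {a}" for a k
    using psubset.IH[of "A - {a} - {k}"] odd2[OF that] that by blast+
  \<comment> \<open>In the expansion along \<open>a\<close> the symmetric double sum reduces modulo
    2 to its diagonal. The minors there are determinants of odd size, even by induction;
    \<open>N a a\<close> is even as well.\<close>
  have "2 dvd det_on N A"
  proof -
    obtain a where a: "a \<in> A" using psubset.prems by fastforce
    let ?h = "\<lambda>k l. N k a * N a l * minor_on N (A - {a}) k l"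
    have "2 dvd (\<Sum>k\<in>A - {a}. \<Sum>l\<in>A - {a}. ?h k l) - (\<Sum>k\<in>A - {a}. ?h k k)"
      using fin dvd_symmetric_sum[of "A - {a}" ?h 1] by (auto simp: sym minor_on_sym mult_ac)
    moreover have "2 dvd (\<Sum>k\<in>A - {a}. ?h k k)"
      using fin IH(1)[OF a] by (intro dvd_sum) (simp add: minor_on_same)
    ultimately have "2 dvd (\<Sum>k\<in>A - {a}. \<Sum>l\<in>A - {a}. ?h k l)"
      by (rule dvd_if_dvd_diff)
    then show ?thesis using diag[of a] by (simp add: det_on_expand[OF fin a])
  qed
  moreover have "2 dvd minor_on N A k l - matching_sum N (A - {k}) * matching_sum N (A - {l})"
    if k: "k \<in> A" and l: "l \<in> A" for k l
  proof (cases "k = l")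
    case kl: True
    show ?thesis
    proof (cases "A - {k} = {}")
      case True
      have "minor_on N A k k = 1" using fin k by (simp only: minor_on_same True det_on_empty)
      moreover have "matching_sum N (A - {k}) = 1" by (simp only: True matching_sum_empty)
      ultimately show ?thesis using kl by simp
    next
      case False
      then obtain a where a: "a \<in> A - {k}" by auto
      let ?B = "A - {k}"
      let ?X = "\<Sum>i\<in>?B - {a}. \<Sum>j\<in>?B - {a}. N i a * N a j * minor_on N (?B - {a}) i j"
      have X: "2 dvd ?X - (matching_sum N ?B)\<^sup>2"
        unfolding matching_sum_square[of ?B a, OF finite_Diff[OF fin] a, symmetric]
        by (intro dvd_diff_sum dvd_diff_mult) (use IH(2)[OF k a] in auto)
      have "minor_on N A k k = N a a * det_on N (?B - {a}) - ?X"
        using fin k a by (simp add: minor_on_same det_on_expand[of ?B a])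
      \<comment> \<open>The expansion carries \<open>- ?X\<close>, while \<open>?X\<close> itself is
        congruent to the square; the change of sign costs an even term.\<close>
      then have "minor_on N A k k - (matching_sum N ?B)\<^sup>2 =
          N a a * det_on N (?B - {a}) - (?X - (matching_sum N ?B)\<^sup>2) - 2 * (matching_sum N ?B)\<^sup>2"
        by (simp only: algebra_simps mult_2)
      also have "2 dvd \<dots>"
        by (intro dvd_diff X dvd_mult2[OF diag] dvd_triv_left)
      finally have "2 dvd minor_on N A k k - (matching_sum N ?B)\<^sup>2" .
      then show ?thesis using kl by (simp add: power2_eq_square)
    qed
  next
    case False
    let ?C = "A - {k} - {l}"
    have C: "A - {k, l} = ?C" "A - {l} - {k} = ?C" by auto
    let ?S = "\<lambda>a. \<Sum>i\<in>?C. N i a * matching_sum N (?C - {i})"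
    have C': "A - {k} - {l, i} = ?C - {i}" "A - {l} - {k, i} = ?C - {i}" for i by auto
    have S: "matching_sum N (A - {k}) = ?S l" "matching_sum N (A - {l}) = ?S k"
      using fin k l False matching_sum_expand[of "A - {k}" l N, OF _ _ sym]
        matching_sum_expand[of "A - {l}" k N, OF _ _ sym]
      by (simp_all add: sym[of l] sym[of k] C C')
    let ?X = "\<Sum>i\<in>?C. \<Sum>j\<in>?C. N i k * N l j * minor_on N ?C i j"
    have "2 dvd ?X - (\<Sum>i\<in>?C. \<Sum>j\<in>?C. N i k * N l j *
        (matching_sum N (?C - {i}) * matching_sum N (?C - {j})))"
      by (intro dvd_diff_sum dvd_diff_mult) (use IH(2)[OF k] l False in auto)
    also have "(\<Sum>i\<in>?C. \<Sum>j\<in>?C. N i k * N l j *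
        (matching_sum N (?C - {i}) * matching_sum N (?C - {j}))) = ?S k * ?S l"
      unfolding sum_product by (intro sum.cong refl) (simp add: sym mult_ac)
    finally have "2 dvd ?X - matching_sum N (A - {k}) * matching_sum N (A - {l})"
      by (simp add: S mult.commute)
    moreover have "2 dvd N l k * det_on N ?C" using IH(1)[OF k] l False by simp
    ultimately have "2 dvd (?X - matching_sum N (A - {k}) * matching_sum N (A - {l})) -
        N l k * det_on N ?C"
      by (rule dvd_diff)
    then show ?thesis
      unfolding minor_on_expand[OF fin k l False] C by (simp only: algebra_simps)
  qed
  ultimately show ?case by blast
qed

text \<open>The determinant and the squared matching sum both expand along \<open>a\<close> into
  symmetric double sums. Off the diagonal the terms agree only modulo 2, but each occurs twice; on
  the diagonal they agree modulo 4 by induction. The minus sign in \<open>det_on_expand\<close>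
  accounts for the step from \<open>(-1) ^ m\<close> to \<open>(-1) ^ Suc m\<close>.\<close>

lemma det_on_even_mod_4:
  assumes "finite A" "card A = 2 * m"
  shows "4 dvd det_on N A - (-1) ^ m * (matching_sum N A)\<^sup>2"
  using assms
proof (induction m arbitrary: A)
  case (Suc m)
  note fin = \<open>finite A\<close>
  obtain a where a: "a \<in> A" using Suc.prems by fastforce
  let ?B = "A - {a}" and ?s = "(-1) ^ m :: 'r"
  have odd: "odd (card ?B)" using Suc.prems a by simp
  let ?p = "\<lambda>k. matching_sum N (?B - {k})"
  let ?h = "\<lambda>k l. N k a * N a l * minor_on N ?B k l - N k a * N a l * (?s * (?p k * ?p l))"
  have four: "2 * 2 = (4::'r)" by simp
  have "4 dvd (\<Sum>k\<in>?B. \<Sum>l\<in>?B. ?h k l) - (\<Sum>k\<in>?B. ?h k k)"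
    unfolding four[symmetric]
  proof (rule dvd_symmetric_sum)
    fix k l assume kl: "k \<in> ?B" "l \<in> ?B"
    then show "?h k l = ?h l k" using fin by (simp add: sym minor_on_sym mult_ac)
    have "2 dvd minor_on N ?B k l - ?p k * ?p l"
      using odd_minors_mod_2[of ?B] odd fin kl by blast
    moreover have "2 dvd ?p k * ?p l - ?s * (?p k * ?p l)"
      by (cases "even m") simp_all
    ultimately have "2 dvd minor_on N ?B k l - ?s * (?p k * ?p l)"
      by (rule dvd_diff_trans)
    then show "2 dvd ?h k l" by (simp add: right_diff_distrib[symmetric])
  qed (use fin in simp)
  moreover have "4 dvd (\<Sum>k\<in>?B. ?h k k)"
  proof (rule dvd_sum)
    fix k assume k: "k \<in> ?B"
    then have "4 dvd det_on N (?B - {k}) - ?s * (?p k)\<^sup>2"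
      using Suc.prems a by (intro Suc.IH) auto
    then show "4 dvd ?h k k"
      using k fin by (simp add: minor_on_same right_diff_distrib[symmetric] power2_eq_square)
  qed
  ultimately have "4 dvd (\<Sum>k\<in>?B. \<Sum>l\<in>?B. ?h k l)"
    by (rule dvd_if_dvd_diff)
  also have "(\<Sum>k\<in>?B. \<Sum>l\<in>?B. ?h k l) =
      (\<Sum>k\<in>?B. \<Sum>l\<in>?B. N k a * N a l * minor_on N ?B k l) -
      ?s * (\<Sum>k\<in>?B. \<Sum>l\<in>?B. N k a * N a l * (?p k * ?p l))"
    by (simp add: sum_subtractf sum_distrib_left mult_ac)
  also have "\<dots> = (\<Sum>k\<in>?B. \<Sum>l\<in>?B. N k a * N a l * minor_on N ?B k l) -
      ?s * (matching_sum N A)\<^sup>2"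
    by (simp add: matching_sum_square[OF fin a])
  finally have 1: "4 dvd (\<Sum>k\<in>?B. \<Sum>l\<in>?B. N k a * N a l * minor_on N ?B k l) -
      ?s * (matching_sum N A)\<^sup>2" .
  \<comment> \<open>Both factors are even, the second because \<open>?B\<close> has odd
    size.\<close>
  have 2: "4 dvd N a a * det_on N ?B"
    unfolding four[symmetric]
    using diag[of a] odd_minors_mod_2[of ?B] odd fin by (intro mult_dvd_mono) auto
  from dvd_diff[OF 2 1]
  show ?case by (simp add: det_on_expand[OF fin a] algebra_simps)
qed simp

end

section \<open>The invariant dpf as a matching sum\<close>

text \<open>The loop hafnian: a sum over all matchings in \<open>A\<close>, with \<open>J\<close>
  the set of matched points and a loop of weight \<open>x k\<close> at each unmatched
  \<open>k\<close>. With row 0 as \<open>x\<close> it becomes dpf.\<close>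

definition weighted_matching_sum ::
  "('i::linorder \<Rightarrow> 'i \<Rightarrow> 'r::comm_ring_1) \<Rightarrow> ('i \<Rightarrow> 'r) \<Rightarrow> 'i set \<Rightarrow> 'r" where
  "weighted_matching_sum T x A =
     (\<Sum>J | J \<subseteq> A \<and> even (card J). matching_sum T J * (\<Prod>k\<in>A - J. x k))"

lemma weighted_matching_sum_empty [simp]: "weighted_matching_sum T x {} = 1"
proof -
  have e: "{J. J \<subseteq> {} \<and> even (card J)} = {{}}" by auto
  show ?thesis unfolding weighted_matching_sum_def e by simp
qed

text \<open>The sets \<open>J\<close> are sorted by whether they contain \<open>a\<close>. If not,
  \<open>a\<close> contributes \<open>x a\<close>; if so, the matching sum of \<open>J\<close> is
  expanded along \<open>a\<close>.\<close>

lemma weighted_matching_sum_expand: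
  assumes "finite A" "a \<in> A" and sym: "\<And>i j. T i j = T j i"
  shows "weighted_matching_sum T x A = x a * weighted_matching_sum T x (A - {a}) +
    (\<Sum>k\<in>A - {a}. T a k * weighted_matching_sum T x (A - {a, k}))"
proof -
  let ?B = "A - {a}"
  let ?E = "{J. J \<subseteq> ?B \<and> even (card J)}" and ?O = "{J. J \<subseteq> ?B \<and> odd (card J)}"
  let ?f = "\<lambda>J. matching_sum T J * (\<Prod>k\<in>A - J. x k)"
  have finB: "finite ?B" using assms by simp
  have fin: "finite ?E" "finite ?O"
    by (rule finite_subset[of _ "Pow ?B"]; use finB in auto)+
  have card: "card (insert a J) = Suc (card J)" if "J \<subseteq> ?B" for J
    using finite_subset[OF that finB] that by (intro card_insert_disjoint) auto
  have "{J. J \<subseteq> A \<and> even (card J)} = ?E \<union> insert a ` ?O"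
  proof (intro equalityI subsetI)
    fix J assume J: "J \<in> {J. J \<subseteq> A \<and> even (card J)}"
    show "J \<in> ?E \<union> insert a ` ?O"
    proof (cases "a \<in> J")
      case True
      then have "J = insert a (J - {a})" by auto
      moreover have "card J = Suc (card (J - {a}))"
        using True J assms(1) finite_subset by (intro card.remove) auto
      then have "odd (card (J - {a}))" using J even_Suc by force
      then have "J - {a} \<in> ?O" using J by blast
      ultimately show ?thesis by blast
    qed (use J in auto)
  qed (use card assms(2) in auto)
  moreover have "?E \<inter> insert a ` ?O = {}" by auto
  ultimately have "weighted_matching_sum T x A = sum ?f ?E + sum ?f (insert a ` ?O)"
    unfolding weighted_matching_sum_def using fin by (simp add: sum.union_disjoint)
  moreover have "sum ?f ?E = x a * weighted_matching_sum T x ?B"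
    unfolding weighted_matching_sum_def sum_distrib_left
  proof (intro sum.cong refl)
    fix J assume "J \<in> ?E"
    then have "A - J = insert a (?B - J)" "a \<notin> ?B - J" using assms(2) by auto
    then show "?f J = x a * (matching_sum T J * (\<Prod>k\<in>?B - J. x k))"
      using finB by (simp add: mult_ac)
  qed
  moreover have "sum ?f (insert a ` ?O) =
      (\<Sum>k\<in>?B. T a k * weighted_matching_sum T x (A - {a, k}))"
  proof -
    have "sum ?f (insert a ` ?O) = (\<Sum>J\<in>?O. ?f (insert a J))"
      by (subst sum.reindex) (auto intro!: inj_onI)
    also have "\<dots> = (\<Sum>J\<in>?O. \<Sum>k\<in>J. T a k * (matching_sum T (J - {k}) *
        (\<Prod>k\<in>?B - J. x k)))"
    proof (intro sum.cong refl)
      fix J assume J: "J \<in> ?O"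
      then have "insert a J - {a} = J" "insert a J - {a, k} = J - {k}" "A - insert a J = ?B - J"
        for k by auto
      moreover have "finite J" using J finB finite_subset by blast
      ultimately show "?f (insert a J) = (\<Sum>k\<in>J. T a k * (matching_sum T (J - {k}) *
          (\<Prod>k\<in>?B - J. x k)))"
        using matching_sum_expand[of "insert a J" a T, OF _ _ sym]
        by (simp add: sum_distrib_left mult_ac)
    qed
    also have "\<dots> = (\<Sum>(J, k)\<in>(SIGMA J:?O. J). T a k * (matching_sum T (J - {k}) *
        (\<Prod>k\<in>?B - J. x k)))"
      using fin finB by (intro sum.Sigma) (auto intro: finite_subset)
    \<comment> \<open>The order of choice is reversed: first the partner \<open>k\<close>, then the
      other matched points \<open>J - {k}\<close>, which are even in number.\<close>
    also have "\<dots> = (\<Sum>(k, J)\<in>(SIGMA k:?B. {J. J \<subseteq> A - {a, k} \<and> even (card J)}).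
        T a k * (matching_sum T J * (\<Prod>k\<in>A - {a, k} - J. x k)))"
    proof (rule sum.reindex_bij_witness[where i = "\<lambda>(k, J). (insert k J, k)"
          and j = "\<lambda>(J, k). (k, J - {k})"])
      fix p assume "p \<in> (SIGMA J:?O. J)"
      then obtain J k where p: "p = (J, k)" "J \<subseteq> ?B" "odd (card J)" "k \<in> J" by auto
      then have "finite J" using finB finite_subset by blast
      then have "card J = Suc (card (J - {k}))" using p by (intro card.remove) auto
      then have "even (card (J - {k}))" using p(3) by presburger
      then show "(\<lambda>(J, k). (k, J - {k})) p \<in>
          (SIGMA k:?B. {J. J \<subseteq> A - {a, k} \<and> even (card J)})"
        using p by auto
      show "(\<lambda>(k, J). (insert k J, k)) ((\<lambda>(J, k). (k, J - {k})) p) = p"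
        using p by (auto simp: insert_absorb)
      have "A - {a, k} - (J - {k}) = ?B - J" using p by auto
      then show "(case (\<lambda>(J, k). (k, J - {k})) p of (k, J) \<Rightarrow>
          T a k * (matching_sum T J * (\<Prod>k\<in>A - {a, k} - J. x k))) =
        (case p of (J, k) \<Rightarrow> T a k * (matching_sum T (J - {k}) * (\<Prod>k\<in>?B - J. x k)))"
        using p by simp
    next
      fix p assume "p \<in> (SIGMA k:?B. {J. J \<subseteq> A - {a, k} \<and> even (card J)})"
      then obtain J k where p: "p = (k, J)" "k \<in> ?B" "J \<subseteq> A - {a, k}" "even (card J)" by auto
      then have "finite J" using assms(1) finite_subset[of J A] by auto
      then show "(\<lambda>(k, J). (insert k J, k)) p \<in> (SIGMA J:?O. J)"
        "(\<lambda>(J, k). (k, J - {k})) ((\<lambda>(k, J). (insert k J, k)) p) = p"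
        using p by (auto simp: card_insert_if)
    qed
    also have "\<dots> = (\<Sum>k\<in>?B. \<Sum>J | J \<subseteq> A - {a, k} \<and> even (card J).
        T a k * (matching_sum T J * (\<Prod>k\<in>A - {a, k} - J. x k)))"
      using assms(1) by (intro sum.Sigma[symmetric]) auto
    finally show ?thesis by (simp add: weighted_matching_sum_def sum_distrib_left)
  qed
  ultimately show ?thesis by simp
qed

text \<open>The subtracted sum counts the term of \<open>J\<close> once for each point of
  \<open>B - J\<close>. That number is odd, so modulo 2 one unmatched point may be singled
  out.\<close>

lemma weighted_matching_sum_odd:
  assumes "finite B" "odd (card B)"
  shows "2 dvd weighted_matching_sum T x B -
    (\<Sum>k\<in>B. x k * weighted_matching_sum T x (B - {k}))"
proof -
  let ?E = "{J. J \<subseteq> B \<and> even (card J)}"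
  let ?f = "\<lambda>J. matching_sum T J * (\<Prod>k\<in>B - J. x k)"
  have fin: "finite ?E"
    by (rule finite_subset[of _ "Pow B"]) (use assms(1) in auto)
  have "(\<Sum>k\<in>B. x k * weighted_matching_sum T x (B - {k})) = (\<Sum>k\<in>B. sum ?f {J \<in> ?E. k \<notin> J})"
    unfolding weighted_matching_sum_def sum_distrib_left
  proof (intro sum.cong)
    fix k J assume k: "k \<in> B" and "J \<in> {J \<in> ?E. k \<notin> J}"
    then have "B - J = insert k (B - {k} - J)" "k \<notin> B - {k} - J" by auto
    then show "x k * (matching_sum T J * prod x (B - {k} - J)) = ?f J"
      using assms(1) by (simp add: mult_ac)
  qed auto
  also have "\<dots> = (\<Sum>J\<in>?E. \<Sum>k | k \<in> B \<and> k \<notin> J. ?f J)"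
    by (rule sum.swap_restrict) (use assms(1) fin in auto)
  also have "\<dots> = (\<Sum>J\<in>?E. of_nat (card (B - J)) * ?f J)"
    by (simp add: set_diff_eq)
  also have "2 dvd weighted_matching_sum T x B - \<dots>"
    unfolding weighted_matching_sum_def
  proof (rule dvd_diff_sum)
    fix J assume J: "J \<in> ?E"
    then have "card B = card J + card (B - J)"
      using assms(1) by (metis (no_types, lifting) card_Diff_subset card_mono finite_subset
          le_add_diff_inverse mem_Collect_eq)
    then obtain m where "card (B - J) = 2 * m + 1"
      using J assms(2) by (metis (no_types, lifting) even_add mem_Collect_eq oddE)
    then have "?f J - of_nat (card (B - J)) * ?f J = 2 * (- of_nat m * ?f J)"
      by (simp add: algebra_simps)
    then show "2 dvd ?f J - of_nat (card (B - J)) * ?f J" by (metis dvd_triv_left)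
  qed
  finally show ?thesis .
qed

text \<open>Induction through expansion along \<open>a\<close>. If \<open>a\<close> is unmatched,
  the rest has odd size and \<open>weighted_matching_sum_odd\<close> singles out another unmatched
  point \<open>k\<close>. The weight \<open>x a * x k\<close> joins the edge weight
  \<open>T a k\<close>, and together they are \<open>Q a k\<close> modulo 2.\<close>

lemma weighted_matching_sum_even:
  assumes "finite A" "even (card A)"
    and sym: "\<And>i j. T i j = T j i" "\<And>i j. Q i j = Q j i"
    and Q: "\<And>i j. i \<in> A \<Longrightarrow> j \<in> A \<Longrightarrow> i \<noteq> j \<Longrightarrow> 2 dvd x i * x j + T i j - Q i j"
  shows "2 dvd weighted_matching_sum T x A - matching_sum Q A"
  using assms(1,2,5)
proof (induction A rule: finite_psubset_induct)
  case (psubset A)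
  note fin = psubset.hyps
  show ?case
  proof (cases "A = {}")
    case False
    then obtain a where a: "a \<in> A" by auto
    have c: "card A = Suc (card (A - {a}))" using fin a by (rule card.remove)
    have e: "A - {a} - {k} = A - {a, k}" for k by auto
    let ?W = "weighted_matching_sum T x"
    have "2 dvd x a * ?W (A - {a}) - x a * (\<Sum>k\<in>A - {a}. x k * ?W (A - {a, k}))"
      using weighted_matching_sum_odd[of "A - {a}" T x] c psubset.prems(1) fin
      by (simp add: right_diff_distrib[symmetric] e)
    then have 1: "2 dvd ?W A - (\<Sum>k\<in>A - {a}. (x a * x k + T a k) * ?W (A - {a, k}))"
      by (simp add: weighted_matching_sum_expand[of A a T x, OF fin a sym(1)]
          sum_distrib_left sum.distrib algebra_simps)
    have 2: "2 dvd (\<Sum>k\<in>A - {a}. (x a * x k + T a k) * ?W (A - {a, k})) -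
        (\<Sum>k\<in>A - {a}. Q a k * matching_sum Q (A - {a, k}))"
    proof (intro dvd_diff_sum dvd_diff_mult)
      fix k assume k: "k \<in> A - {a}"
      show "2 dvd x a * x k + T a k - Q a k" using psubset.prems(2) a k by auto
      have "card (A - {a}) = Suc (card (A - {a, k}))"
        using card.remove[of "A - {a}" k] fin k by (simp add: e)
      then have "even (card (A - {a, k}))" using c psubset.prems(1) by presburger
      then show "2 dvd ?W (A - {a, k}) - matching_sum Q (A - {a, k})"
        using a psubset.prems(2) by (intro psubset.IH) auto
    qed
    show ?thesis
      unfolding matching_sum_expand[of A a Q, OF fin a sym(2)] by (rule dvd_diff_trans[OF 1 2])
  qed simp
qed

lemma dpf_mat_eq_weighted_matching_sum:
  "dpf_mat (mat (Suc n) (Suc n) (\<lambda>(i, j). t i j)) = weighted_matching_sum t (t 0) {1..<Suc n}"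
  unfolding dpf_mat_def weighted_matching_sum_def matching_sum_def sum_distrib_right dim_row_mat
proof (intro sum.cong refl arg_cong2[of _ _ _ _ times] prod.cong)
  fix J P e assume J: "J \<in> {J. J \<subseteq> {1..<Suc n} \<and> even (card J)}" and P: "P \<in> perfect_matchings J"
    and e: "e \<in> P"
  then have "e \<subseteq> {1..<Suc n}" "card e = 2"
    by (auto simp: perfect_matchings_def partition_on_def)
  moreover from this have "finite e" "e \<noteq> {}"
    by (auto intro: card_ge_0_finite)
  then have "Min e \<in> e" "Max e \<in> e" by simp_all
  ultimately have "Min e \<in> {1..<Suc n}" "Max e \<in> {1..<Suc n}" by blast+
  then show "mat (Suc n) (Suc n) (\<lambda>(i, j). t i j) $$ (Min e, Max e) = t (Min e) (Max e)"
    by simp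
qed auto

section \<open>Bordered matrices\<close>

text \<open>An entry function instead of a matrix, so that both \<open>mat\<close> and
  \<open>det_on\<close> apply. Index 0 is the border and the body is shifted by one, as in
  \<open>ext_basis\<close>.\<close>

definition border ::
  "'r \<Rightarrow> (nat \<Rightarrow> 'r) \<Rightarrow> (nat \<Rightarrow> 'r) \<Rightarrow> (nat \<Rightarrow> nat \<Rightarrow> 'r) \<Rightarrow> nat \<Rightarrow> nat \<Rightarrow> 'r" where
  "border c r s M i j = (case i of
     0 \<Rightarrow> (case j of 0 \<Rightarrow> c | Suc l \<Rightarrow> r l)
   | Suc k \<Rightarrow> (case j of 0 \<Rightarrow> s k | Suc l \<Rightarrow> M k l))"

lemma border_simps [simp]:
  "border c r s M 0 0 = c"
  "border c r s M 0 (Suc l) = r l"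
  "border c r s M (Suc k) 0 = s k"
  "border c r s M (Suc k) (Suc l) = M k l"
  by (simp_all add: border_def)

lemma det_mat_eq_det_on: "det (mat m m (\<lambda>(i, j). f i j)) = det_on f {0..<m}"
  unfolding det_def'[OF mat_carrier] det_on_def
proof (intro sum.cong refl arg_cong2[of _ _ _ _ times] prod.cong)
  fix \<sigma> i assume "\<sigma> \<in> {\<sigma>. \<sigma> permutes {0..<m}}" and i: "i \<in> {0..<m}"
  then have "\<sigma> i \<in> {0..<m}" by (simp only: mem_Collect_eq permutes_in_image)
  then show "mat m m (\<lambda>(i, j). f i j) $$ (i, \<sigma> i) = f i (\<sigma> i)" using i by simp
qed

lemma mat_border_mult:
  "mat (Suc n) (Suc n) (\<lambda>(i, j). border c r s M i j) *
     mat (Suc n) (Suc n) (\<lambda>(i, j). border c' r' s' M' i j) =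
   mat (Suc n) (Suc n) (\<lambda>(i, j). border
     (c * c' + (\<Sum>k<n. r k * s' k))
     (\<lambda>l. c * r' l + (\<Sum>k<n. r k * M' k l))
     (\<lambda>i. s i * c' + (\<Sum>k<n. M i k * s' k))
     (\<lambda>i l. s i * r' l + (\<Sum>k<n. M i k * M' k l)) i j)"
  (is "?A * ?B = ?C")
proof (rule eq_matI)
  fix i j assume "i < dim_row ?C" "j < dim_col ?C"
  then have ij: "i < Suc n" "j < Suc n" by simp_all
  then have "(?A * ?B) $$ (i, j) = (\<Sum>k<Suc n. border c r s M i k * border c' r' s' M' k j)"
    by (auto simp: scalar_prod_def atLeast0LessThan intro!: sum.cong)
  also have "\<dots> = ?C $$ (i, j)"
    using ij unfolding sum.lessThan_Suc_shift by (cases i; cases j) simp_all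
  finally show "(?A * ?B) $$ (i, j) = ?C $$ (i, j)" .
qed simp_all

lemma det_border_unit:
  "det (mat (Suc n) (Suc n) (\<lambda>(i, j). border 1 (\<lambda>_. 0) s (\<lambda>k l. if k = l then 1 else 0) i j)) =
    (1 :: 'r::comm_ring_1)"
    (is "det ?A = _")
proof -
  have "det ?A = prod_list (diag_mat ?A)"
  proof (rule det_lower_triangular)
    fix i j :: nat assume "i < j" "j < Suc n"
    then show "?A $$ (i, j) = 0" by (cases i; cases j) simp_all
  qed simp
  also have "diag_mat ?A = map (\<lambda>_. 1) [0..<Suc n]"
    unfolding diag_mat_def
  proof (intro map_cong)
    fix i assume "i \<in> set [0..<Suc n]"
    then have "i < Suc n" by (simp del: upt_Suc)
    then show "?A $$ (i, i) = 1" by (cases i) simp_all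
  qed simp
  also have "prod_list (map (\<lambda>_. 1 :: 'r) [0..<Suc n]) = 1"
    by (simp only: map_replicate_const prod_list_replicate power_one)
  finally show ?thesis .
qed

lemma det_border_zero:
  "det (mat (Suc n) (Suc n) (\<lambda>(i, j). border c r (\<lambda>_. 0) M i j)) =
    c * det (mat n n (\<lambda>(i, j). M i j))"
proof -
  have "mat (Suc n) (Suc n) (\<lambda>(i, j). border c r (\<lambda>_. 0) M i j) =
      four_block_mat (mat 1 1 (\<lambda>_. c)) (mat 1 n (\<lambda>(i, j). r j)) (0\<^sub>m n 1) (mat n n (\<lambda>(i, j). M i j))"
    (is "?A = ?B")
  proof (rule eq_matI)
    fix i j assume "i < dim_row ?B" "j < dim_col ?B"
    then show "?A $$ (i, j) = ?B $$ (i, j)" by (cases i; cases j) simp_all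
  qed simp_all
  also have "det \<dots> = det (mat 1 1 (\<lambda>_. c)) * det (mat n n (\<lambda>(i, j). M i j))"
    by (rule det_four_block_mat_lower_left_zero_col) (rule refl mat_carrier)+
  also have "det (mat 1 1 (\<lambda>_. c)) = c" by (simp add: det_single)
  finally show ?thesis .
qed

text \<open>The matrix \<open>border c x x T\<close> is factored as \<open>?L * ?Y\<close> and as
  \<open>?U * ?V\<close>, with \<open>?L\<close> and \<open>?V\<close> unitriangular. The parameter
  serves both parities of \<open>n\<close>: \<open>c = 0\<close> gives the symmetric bordered
  matrix, and \<open>c = 1\<close> clears the first column below the corner.\<close>

lemma det_border_rank_one_update:
  fixes T :: "nat \<Rightarrow> nat \<Rightarrow> 'r::comm_ring_1"
  assumes "\<And>i. i < n \<Longrightarrow> (\<Sum>j<n. T i j * a j) = x i"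
  shows "det (mat (Suc n) (Suc n)
      (\<lambda>(i, j). border c x (\<lambda>k. (1 - c) * x k) (\<lambda>k l. T k l - x k * x l) i j)) =
    (c - (\<Sum>j<n. x j * a j)) * det (mat n n (\<lambda>(i, j). T i j))"
proof -
  let ?m = "\<lambda>f. mat (Suc n) (Suc n) (\<lambda>(i, j). f i j)"
  let ?I = "\<lambda>k l. if k = l then 1 else 0 :: 'r"
  let ?d = "\<Sum>j<n. x j * a j"
  let ?L = "?m (border 1 (\<lambda>_. 0) x ?I)" and ?V = "?m (border 1 (\<lambda>_. 0) a ?I)"
  let ?Y = "?m (border c x (\<lambda>k. (1 - c) * x k) (\<lambda>k l. T k l - x k * x l))"
  let ?U = "?m (border (c - ?d) x (\<lambda>_. 0) T)"
  let ?X = "?m (border c x x T)"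
  have delta: "(\<Sum>k<n. (if i = k then 1 else 0) * f k) = f i"
    "(\<Sum>k<n. f k * (if k = i then 1 else 0)) = f i" if "i < n" for i and f :: "nat \<Rightarrow> 'r"
  proof -
    have "(\<Sum>k<n. (if i = k then 1 else 0) * f k) = (\<Sum>k<n. if i = k then f k else 0)"
      "(\<Sum>k<n. f k * (if k = i then 1 else 0)) = (\<Sum>k<n. if i = k then f k else 0)"
      by (intro sum.cong refl; auto)+
    then show "(\<Sum>k<n. (if i = k then 1 else 0) * f k) = f i"
      "(\<Sum>k<n. f k * (if k = i then 1 else 0)) = f i"
      using that by simp_all
  qed
  \<comment> \<open>Adding \<open>x i\<close> times the top row to row \<open>Suc i\<close> cancels
    the rank-one term and makes the first column \<open>x\<close>.\<close>
  have "?L * ?Y = ?X"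
    unfolding mat_border_mult
  proof (rule cong_mat[OF refl refl])
    fix i j assume "i < Suc n" "j < Suc n"
    then show "(case (i, j) of (i, j) \<Rightarrow> border (1 * c + (\<Sum>k<n. 0 * ((1 - c) * x k)))
        (\<lambda>l. 1 * x l + (\<Sum>k<n. 0 * (T k l - x k * x l)))
        (\<lambda>i. x i * c + (\<Sum>k<n. ?I i k * ((1 - c) * x k)))
        (\<lambda>i l. x i * x l + (\<Sum>k<n. ?I i k * (T k l - x k * x l))) i j) =
      (case (i, j) of (i, j) \<Rightarrow> border c x x T i j)"
      by (cases i; cases j; simp add: delta; simp add: algebra_simps)
  qed
  \<comment> \<open>Adding the other columns, weighted by \<open>a\<close>, to the first one creates
    \<open>x\<close> there and restores the corner \<open>c\<close>.\<close>
  moreover have "?U * ?V = ?X"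
    unfolding mat_border_mult
  proof (rule cong_mat[OF refl refl])
    fix i j assume "i < Suc n" "j < Suc n"
    then show "(case (i, j) of (i, j) \<Rightarrow> border ((c - ?d) * 1 + (\<Sum>k<n. x k * a k))
        (\<lambda>l. (c - ?d) * 0 + (\<Sum>k<n. x k * ?I k l))
        (\<lambda>i. 0 * 1 + (\<Sum>k<n. T i k * a k))
        (\<lambda>i l. 0 * 0 + (\<Sum>k<n. T i k * ?I k l)) i j) =
      (case (i, j) of (i, j) \<Rightarrow> border c x x T i j)"
      by (cases i; cases j) (simp_all add: delta assms)
  qed
  ultimately have "det (?L * ?Y) = det (?U * ?V)" by simp
  then have "det ?L * det ?Y = det ?U * det ?V"
    by (simp add: det_mult[of _ "Suc n"])
  then show ?thesis by (simp add: det_border_unit det_border_zero)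
qed

section \<open>The trace form\<close>

context central_algebra
begin

context
  fixes \<beta> :: "'a list"
  assumes basis: "is_basis emb \<beta>"
begin

section \<open>Coordinates with respect to a basis\<close>

lemma coord_sum: "(\<Sum>i<length \<beta>. emb (coord emb \<beta> a i) * \<beta> ! i) = a"
proof -
  interpret M: Modules.module "smul emb" by (rule module_smul)
  have b: "distinct \<beta>" "\<not> M.dependent (set \<beta>)" "M.span (set \<beta>) = UNIV"
    using basis by (auto simp: is_basis_def)
  have "a = (\<Sum>v\<in>set \<beta>. smul emb (M.representation (set \<beta>) a v) v)"
    using b by (intro M.sum_representation_eq[symmetric]) auto
  also have "\<dots> = (\<Sum>i<length \<beta>. smul emb (M.representation (set \<beta>) a (\<beta> ! i)) (\<beta> ! i))"
    using bij_betw_nth[OF b(1) refl refl] by (intro sum.reindex_bij_betw[symmetric]) simp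
  finally show ?thesis by (simp add: coord_def smul_def)
qed

lemma coord_linear:
  "coord emb \<beta> (\<Sum>i\<in>S. emb (c i) * v i) j = (\<Sum>i\<in>S. c i * coord emb \<beta> (v i) j)"
proof -
  interpret M: Modules.module "smul emb" by (rule module_smul)
  have b: "\<not> M.dependent (set \<beta>)" "M.span (set \<beta>) = UNIV"
    using basis by (auto simp: is_basis_def)
  have "M.representation (set \<beta>) (\<Sum>i\<in>S. smul emb (c i) (v i)) =
      (\<lambda>b. \<Sum>i\<in>S. c i * M.representation (set \<beta>) (v i) b)"
    using b by (simp add: M.representation_sum M.representation_scale)
  then show ?thesis by (simp add: coord_def smul_def)
qed

lemma coord_basis:
  assumes "i < length \<beta>" "j < length \<beta>"
  shows "coord emb \<beta> (\<beta> ! i) j = (if i = j then 1 else 0)"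
proof -
  interpret M: Modules.module "smul emb" by (rule module_smul)
  show ?thesis
    using basis assms M.representation_basis[of "set \<beta>" "\<beta> ! i"]
    by (auto simp: coord_def is_basis_def nth_eq_iff_index_eq)
qed

lemma coord_unique:
  assumes "j < length \<beta>" "a = (\<Sum>i<length \<beta>. emb (c i) * \<beta> ! i)"
  shows "coord emb \<beta> a j = c j"
proof -
  have "coord emb \<beta> a j = (\<Sum>i<length \<beta>. if i = j then c i else 0)"
    unfolding assms(2) coord_linear
    using assms(1) by (intro sum.cong refl) (simp add: coord_basis)
  then show ?thesis using assms(1) by (simp add: sum.delta)
qed

section \<open>Traces of left multiplications\<close>

abbreviation (input) "tr a \<equiv> mat_trace (left_mult_mat emb \<beta> a)"

lemma trace_alt: "tr a = (\<Sum>i<length \<beta>. coord emb \<beta> (a * \<beta> ! i) i)"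
  by (simp add: mat_trace_def left_mult_mat_def)

lemma trace_linear: "tr (\<Sum>i\<in>S. emb (c i) * v i) = (\<Sum>i\<in>S. c i * tr (v i))"
  unfolding trace_alt sum_distrib_right sum_distrib_left mult.assoc coord_linear
  by (rule sum.swap)

lemma trace_one: "tr 1 = of_nat (length \<beta>)"
  by (simp add: trace_alt coord_basis)

lemma trace_mult:
  "tr (a * b) = (\<Sum>i<length \<beta>. \<Sum>j<length \<beta>.
     coord emb \<beta> (a * \<beta> ! j) i * coord emb \<beta> (b * \<beta> ! i) j)"
  unfolding trace_alt
proof (intro sum.cong refl)
  fix i
  have "a * b * \<beta> ! i = a * (\<Sum>j<length \<beta>. emb (coord emb \<beta> (b * \<beta> ! i) j) * \<beta> ! j)"
    by (simp add: coord_sum mult.assoc)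
  \<comment> \<open>Centrality moves the coefficients to the left of \<open>a\<close>.\<close>
  also have "\<dots> = (\<Sum>j<length \<beta>. emb (coord emb \<beta> (b * \<beta> ! i) j) * (a * \<beta> ! j))"
    unfolding sum_distrib_left by (intro sum.cong refl) (metis central mult.assoc)
  finally show "coord emb \<beta> (a * b * \<beta> ! i) i =
      (\<Sum>j<length \<beta>. coord emb \<beta> (a * \<beta> ! j) i * coord emb \<beta> (b * \<beta> ! i) j)"
    by (simp add: coord_linear mult.commute)
qed

text \<open>Swapping the summation indices in \<open>trace_mult\<close> swaps \<open>a\<close> and
  \<open>b\<close>. Hence the Gram matrix is symmetric even for noncommutative algebras.\<close>

lemma trace_commute: "tr (a * b) = tr (b * a)"
  unfolding trace_mult by (subst sum.swap) (simp add: mult.commute)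

text \<open>Both terms are double sums symmetric in the two indices, with the same diagonal, to
  which they reduce modulo 2.\<close>

lemma trace_square_mod_2: "2 dvd tr (a * a) - (tr a)\<^sup>2"
proof -
  let ?L = "\<lambda>i j. coord emb \<beta> (a * \<beta> ! j) i"
  have 1: "2 dvd tr (a * a) - (\<Sum>i<length \<beta>. ?L i i * ?L i i)"
    using dvd_symmetric_sum[of "{..<length \<beta>}" "\<lambda>i j. ?L i j * ?L j i" 1]
    by (simp add: trace_mult mult.commute)
  have 2: "2 dvd (tr a)\<^sup>2 - (\<Sum>i<length \<beta>. ?L i i * ?L i i)"
    using dvd_symmetric_sum[of "{..<length \<beta>}" "\<lambda>i j. ?L i i * ?L j j" 1]
    by (simp add: trace_alt power2_eq_square sum_product mult.commute)
  from dvd_diff[OF 1 2] show ?thesis by simp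
qed

section \<open>The trace form of the product algebra\<close>

lemma length_ext_basis: "length (ext_basis \<beta> :: ('r \<times> 'a) list) = Suc (length \<beta>)"
  by (simp add: ext_basis_def)

lemma ext_basis_nth:
  "ext_basis \<beta> ! 0 = (1 :: 'r, 1)"
  "k < length \<beta> \<Longrightarrow> ext_basis \<beta> ! Suc k = (0 :: 'r, \<beta> ! k)"
  by (simp_all add: ext_basis_def)

text \<open>Reflects the decomposition of \<open>(r, a)\<close> as \<open>r\<close> times
  \<open>(1, 1)\<close> plus \<open>(0, a - emb r)\<close>.\<close>

lemma coord_ext:
  assumes "i < Suc (length \<beta>)"
  shows "coord (ext_emb emb) (ext_basis \<beta>) (r, a) i =
    (case i of 0 \<Rightarrow> r | Suc k \<Rightarrow> coord emb \<beta> (a - emb r) k)"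
proof -
  interpret E: central_algebra "ext_emb emb" by (rule central_algebra_ext)
  let ?c = "\<lambda>i. case i of 0 \<Rightarrow> r | Suc k \<Rightarrow> coord emb \<beta> (a - emb r) k"
  have pair: "(\<Sum>k\<in>S. (0::'r, f k)) = (0, \<Sum>k\<in>S. f k)" for S :: "nat set" and f :: "nat \<Rightarrow> 'a"
    by (induction S rule: infinite_finite_induct) (auto simp: zero_prod_def)
  have "(\<Sum>i<Suc (length \<beta>). ext_emb emb (?c i) * ext_basis \<beta> ! i) =
      (r, emb r) + (\<Sum>k<length \<beta>. (0, emb (coord emb \<beta> (a - emb r) k) * \<beta> ! k))"
    unfolding sum.lessThan_Suc_shift
    by (simp add: ext_basis_nth ext_emb_def times_prod_def)
  also have "\<dots> = (r, a)"
    by (simp add: pair coord_sum)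
  finally show ?thesis
    using assms by (intro E.coord_unique[OF is_basis_ext[OF basis]]) (simp_all add: length_ext_basis)
qed

text \<open>The basis element \<open>(1, 1)\<close> contributes the first coordinate of
  \<open>(r, a)\<close>, and each \<open>(0, e)\<close> is sent to \<open>(0, a * e)\<close>, whose
  later coordinates are those of \<open>a * e\<close>.\<close>

lemma trace_ext:
  "mat_trace (left_mult_mat (ext_emb emb) (ext_basis \<beta>) (r, a)) = r + tr a"
proof -
  interpret E: central_algebra "ext_emb emb" by (rule central_algebra_ext)
  have "mat_trace (left_mult_mat (ext_emb emb) (ext_basis \<beta>) (r, a)) =
      coord (ext_emb emb) (ext_basis \<beta>) (r, a) 0 +
      (\<Sum>k<length \<beta>. coord (ext_emb emb) (ext_basis \<beta>) (0, a * \<beta> ! k) (Suc k))"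
    unfolding E.trace_alt[OF is_basis_ext[OF basis]] length_ext_basis sum.lessThan_Suc_shift
    by (intro arg_cong2[of _ _ _ _ plus] sum.cong refl)
      (simp_all add: ext_basis_nth times_prod_def)
  also have "\<dots> = r + (\<Sum>k<length \<beta>. coord emb \<beta> (a * \<beta> ! k) k)"
    by (intro arg_cong2[of _ _ _ _ plus] sum.cong refl) (simp_all add: coord_ext)
  finally show ?thesis by (simp only: trace_alt)
qed

text \<open>The products with \<open>(1, 1)\<close> put the traces of the basis elements into the
  border; these are the weights that dpf takes from row 0.\<close>

lemma gram_ext:
  "gram (ext_emb emb) (ext_basis \<beta>) = mat (Suc (length \<beta>)) (Suc (length \<beta>)) (\<lambda>(i, j).
    border (1 + of_nat (length \<beta>)) (\<lambda>k. tr (\<beta> ! k)) (\<lambda>k. tr (\<beta> ! k))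
      (\<lambda>k l. tr (\<beta> ! k * \<beta> ! l)) i j)"
    (is "_ = mat _ _ ?f")
  unfolding gram_def trace_form_def length_ext_basis
proof (rule cong_mat[OF refl refl])
  fix i j assume "i < Suc (length \<beta>)" "j < Suc (length \<beta>)"
  then show "(case (i, j) of (i, j) \<Rightarrow>
      mat_trace (left_mult_mat (ext_emb emb) (ext_basis \<beta>) (ext_basis \<beta> ! i * ext_basis \<beta> ! j))) =
      ?f (i, j)"
    by (cases i; cases j) (simp_all add: ext_basis_nth times_prod_def trace_ext trace_one)
qed

end

end

section \<open>The congruence\<close>

theorem theorem3p13:
  fixes emb :: "'r::comm_ring_1 \<Rightarrow> 'a::ring_1" and \<beta> :: "'a list"
  assumes "central_algebra emb"
    and "is_basis emb \<beta>"
  shows "4 dvd disc emb \<beta> - (dpf (ext_emb emb) (ext_basis \<beta>))\<^sup>2"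
proof -
  interpret central_algebra emb by fact
  note basis = assms(2)
  define n where "n = length \<beta>"
  define T where "T k l = mat_trace (left_mult_mat emb \<beta> (\<beta> ! k * \<beta> ! l))" for k l
  define x where "x k = mat_trace (left_mult_mat emb \<beta> (\<beta> ! k))" for k
  define a where "a = coord emb \<beta> 1"
  \<comment> \<open>The parameter of \<open>det_border_rank_one_update\<close>: 1 leads to the
    determinant without border, 0 to the bordered one.\<close>
  define c :: 'r where "c = (if even n then 1 else 0)"
  define t where "t = border (1 + of_nat n) x x T"
  \<comment> \<open>One matrix for both parities: index 0 is the border, and \<open>I\<close> keeps
    it exactly when \<open>n\<close> is odd, so that \<open>I\<close> has the even size
    \<open>2 * m\<close>.\<close>
  define N where "N = border 0 x x (\<lambda>k l. T k l - x k * x l)"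
  define I where "I = (if even n then {1..<Suc n} else {0..<Suc n})"
  define m where "m = (n + 1) div 2"
  define s :: 'r where "s = (-1) ^ m"
  have one: "(\<Sum>j<n. emb (a j) * \<beta> ! j) = 1"
    using coord_sum[OF basis, of 1] by (simp add: n_def a_def)
  have T_sym: "T k l = T l k" for k l
    unfolding T_def by (rule trace_commute[OF basis])
  have Ta: "(\<Sum>j<n. T i j * a j) = x i" for i
  proof -
    have "x i = mat_trace (left_mult_mat emb \<beta> ((\<Sum>j<n. emb (a j) * \<beta> ! j) * \<beta> ! i))"
      by (simp add: x_def one)
    also have "\<dots> = (\<Sum>j<n. a j * T j i)"
      unfolding sum_distrib_right mult.assoc trace_linear[OF basis] T_def ..
    finally show ?thesis by (simp add: T_sym mult.commute)
  qed
  have xa: "(\<Sum>j<n. x j * a j) = of_nat n"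
  proof -
    have "of_nat n = mat_trace (left_mult_mat emb \<beta> 1)"
      by (simp only: n_def trace_one[OF basis])
    also have "\<dots> = mat_trace (left_mult_mat emb \<beta> (\<Sum>j<n. emb (a j) * \<beta> ! j))"
      by (simp only: one)
    finally show ?thesis by (simp add: trace_linear[OF basis] x_def mult.commute)
  qed
  have disc: "disc emb \<beta> = det (mat n n (\<lambda>(i, j). T i j))"
    by (simp add: disc_def gram_def trace_form_def T_def n_def)
  have dpf: "dpf (ext_emb emb) (ext_basis \<beta>) = weighted_matching_sum t (t 0) {1..<Suc n}"
    unfolding dpf_def gram_ext[OF basis] dpf_mat_eq_weighted_matching_sum
    by (simp add: t_def n_def x_def[abs_def] T_def[abs_def])
  have sym: "t i j = t j i" "N i j = N j i" for i j
    by (cases i; cases j; simp add: t_def N_def T_sym mult.commute)+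
  \<comment> \<open>This covers all indices: the corner is 0, and \<open>trace_square_mod_2\<close>
    holds for any element, also for whatever \<open>\<beta> ! k\<close> denotes beyond the
    list.\<close>
  have diag: "2 dvd N i i" for i
    using trace_square_mod_2[OF basis]
    by (cases i) (simp_all add: N_def T_def x_def power2_eq_square)

  have even_case: "2 dvd weighted_matching_sum t (t 0) A - matching_sum N A"
    if "finite A" "even (card A)" "A \<subseteq> {1..<Suc n}" for A
  proof (rule weighted_matching_sum_even[OF that(1,2) sym])
    fix i j assume "i \<in> A" "j \<in> A"
    then have "i \<in> {1..<Suc n}" "j \<in> {1..<Suc n}" using that(3) by blast+
    then show "2 dvd t 0 i * t 0 j + t i j - N i j"
      by (cases i; cases j) (simp_all add: t_def N_def)
  qed
  have dpf_mod_2: "2 dvd dpf (ext_emb emb) (ext_basis \<beta>) - matching_sum N I"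
  proof (cases "even n")
    case True
    then show ?thesis
      unfolding dpf I_def using even_case[of "{1..<Suc n}"] by simp
  next
    case False
    \<comment> \<open>For odd \<open>n\<close>, the border index 0 becomes the partner of the
      unmatched point singled out by \<open>weighted_matching_sum_odd\<close>; the weight
      \<open>t 0 k\<close> of that point is the edge weight \<open>N 0 k\<close>.\<close>
    have W: "2 dvd (\<Sum>k\<in>{1..<Suc n}. t 0 k * weighted_matching_sum t (t 0) ({1..<Suc n} - {k})) -
        (\<Sum>k\<in>{1..<Suc n}. N 0 k * matching_sum N ({1..<Suc n} - {k}))"
    proof (intro dvd_diff_sum dvd_diff_mult)
      fix k assume k: "k \<in> {1..<Suc n}"
      then show "2 dvd t 0 k - N 0 k" by (cases k) (simp_all add: t_def N_def)
      show "2 dvd weighted_matching_sum t (t 0) ({1..<Suc n} - {k}) -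
          matching_sum N ({1..<Suc n} - {k})"
        using False k by (intro even_case) auto
    qed
    have e: "{0..<Suc n} - {0} = {1..<Suc n}" "{0..<Suc n} - {0, k} = {1..<Suc n} - {k}" for k
      by auto
    have "matching_sum N {0..<Suc n} =
        (\<Sum>k\<in>{1..<Suc n}. N 0 k * matching_sum N ({1..<Suc n} - {k}))"
      by (subst matching_sum_expand[of "{0..<Suc n}" 0 N, OF _ _ sym(2)]) (simp_all only: e, simp_all)
    moreover have "odd (card {1..<Suc n})" using False by simp
    ultimately show ?thesis
      using dvd_diff_trans[OF weighted_matching_sum_odd[of "{1..<Suc n}"] W] False
      by (simp only: dpf I_def if_False finite_atLeastLessThan simp_thms)
  qed

  have "det_on N I = det (mat (Suc n) (Suc n)
      (\<lambda>(i, j). border c x (\<lambda>k. (1 - c) * x k) (\<lambda>k l. T k l - x k * x l) i j))"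
    (is "_ = det (mat _ _ (\<lambda>(i, j). ?Y i j))")
  proof (cases "even n")
    case True
    have e: "{0..<Suc n} - {0} = {1..<Suc n}" by auto
    have zero_in: "0 \<in> {0..<Suc n}" by simp
    \<comment> \<open>As \<open>c = 1\<close>, the first column vanishes below a corner equal to 1,
      so index 0 can be deleted.\<close>
    have "?Y k 0 = 0" if "k \<in> {1..<Suc n}" for k
      using that True by (cases k) (simp_all add: c_def)
    then have "det_on ?Y {0..<Suc n} = det_on ?Y {1..<Suc n}"
      using True unfolding det_on_expand[of "{0..<Suc n}" 0 ?Y, OF finite_atLeastLessThan zero_in] e
      by (simp add: c_def)
    also have "\<dots> = det_on N {1..<Suc n}"
    proof (rule det_on_cong)
      fix i j assume "i \<in> {1..<Suc n}" "j \<in> {1..<Suc n}"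
      then show "?Y i j = N i j" by (cases i; cases j) (simp_all add: N_def)
    qed
    finally show ?thesis using True by (simp add: I_def det_mat_eq_det_on)
  next
    case False
    then show ?thesis by (simp add: I_def det_mat_eq_det_on N_def c_def)
  qed
  also have "\<dots> = (c - of_nat n) * disc emb \<beta>"
    unfolding disc xa[symmetric] by (rule det_border_rank_one_update) (rule Ta)
  finally have det_N: "det_on N I = (c - of_nat n) * disc emb \<beta>" .

  have card_I: "finite I" "card I = 2 * m"
    by (simp_all add: I_def m_def)
  have c: "c - of_nat n = 1 - 2 * of_nat m"
  proof (cases "even n")
    case True
    then have "n = 2 * m" by (simp add: m_def)
    then show ?thesis using True by (simp add: c_def)
  next
    case False
    then have "Suc n = 2 * m" by (simp add: m_def)
    then have "of_nat (Suc n) = (of_nat (2 * m) :: 'r)" by (rule arg_cong)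
    then have "of_nat n = 2 * of_nat m - (1 :: 'r)" by (simp add: algebra_simps)
    then show ?thesis using False by (simp add: c_def)
  qed
  have s: "4 dvd c - of_nat n - s"
  proof -
    \<comment> \<open>With \<open>k\<close> the integer half of \<open>m\<close>, the difference is
      \<open>- 4 * k\<close> for both parities.\<close>
    obtain k where "m = 2 * k \<or> m = 2 * k + 1" using evenE oddE by metis
    then have "c - of_nat n - s = 4 * (- of_nat k)"
      unfolding c s_def by (elim disjE) (simp_all add: algebra_simps)
    then show ?thesis by (metis dvd_triv_left)
  qed
  have ss: "s * s = 1" by (simp add: s_def flip: power_mult_distrib)
  have "4 dvd det_on N I - s * (matching_sum N I)\<^sup>2"
    unfolding s_def by (rule det_on_even_mod_4[of N, OF sym(2) diag card_I])
  \<comment> \<open>Replacing the factor \<open>c - of_nat n\<close> by \<open>s\<close> leaves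
    \<open>s\<close> as a common factor, which is removed by multiplying with \<open>s\<close> once
    more.\<close>
  from dvd_diff[OF this dvd_mult2[OF s, of "disc emb \<beta>"]]
  have "4 dvd s * (disc emb \<beta> - (matching_sum N I)\<^sup>2)"
    by (simp add: det_N algebra_simps)
  then have "4 dvd s * (s * (disc emb \<beta> - (matching_sum N I)\<^sup>2))"
    by (rule dvd_mult)
  then have 1: "4 dvd disc emb \<beta> - (matching_sum N I)\<^sup>2"
    by (simp add: mult.assoc[symmetric] ss)
  have "4 dvd (dpf (ext_emb emb) (ext_basis \<beta>))\<^sup>2 - (matching_sum N I)\<^sup>2"
    using dpf_mod_2 by (rule dvd_square_diff)
  from dvd_diff[OF 1 this] show ?thesis by simp
qed

end
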